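(* Suppose that the power series $f(x)=\sum_{n\geq0}a_nx^n$ is convergent for all $x\in(0,1)$, where $a_n\in\mathbb{R}$ for all $n\in\{0,1,\dots\}$, and assume that the sequence $\{a_n\cdot\omega_n\}_{n\geq0}$ is increasing. Then the function $x\mapsto f(x)/\mathcal{K}(\sqrt{x})$ is increasing on $(0,1)$, and, with the notation $\lambda_f(x)=f(x^2)$, for all $r\in(0,1)$ we have $$\lambda_f\left(\frac{2\sqrt{r}}{1+r}\right)\geq(1+r)\cdot\lambda_f(r).$$ Moreover, if (instead) the sequence $\{a_n\cdot\omega_n\}_{n\geq0}$ is decreasing, then $x\mapsto f(x)/\mathcal{K}(\sqrt{x})$ is decreasing on $(0,1)$, and consequently the inequality $\lambda_f\left(\frac{2\sqrt{r}}{1+r}\right)\geq(1+r)\cdot\lambda_f(r)$ is reversed, that is, $\lambda_f\left(\frac{2\sqrt{r}}{1+r}\right)\leq(1+r)\cdot\lambda_f(r)$ for all $r\in(0,1)$.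
   Context: The sequence $\{\omega_n\}_{n\geq0}$ is defined by $\omega_n=\left[\frac{(1)_n}{\left(\frac12\right)_n}\right]^2=\pi\left[\frac{\Gamma(n+1)}{\Gamma\left(n+\frac12\right)}\right]^2$, where $(a)_0=1$ and $(a)_n=a(a+1)\cdots(a+n-1)$ for $n\geq1$ is the Pochhammer symbol. The complete elliptic integral of the first kind is $\mathcal{K}(r)=\int_0^{\pi/2}(1-r^2\sin^2t)^{-1/2}\,dt$ for $r\in(0,1)$; equivalently $\mathcal{K}(r)=\frac{\pi}{2}\sum_{n\geq0}\frac{\left(\frac12\right)_n\left(\frac12\right)_n}{(1)_n}\cdot\frac{r^{2n}}{n!}$. "Increasing" and "decreasing" are understood in the weak sense (non-decreasing, non-increasing), both for sequences and for functions. *)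

theory Defs
  imports "HOL-Analysis.Analysis"
begin

definition omega :: "nat \<Rightarrow> real" where
  "omega n = (pochhammer 1 n / pochhammer (1/2) n)\<^sup>2"

text \<open>
  The complete elliptic integral of the first kind. The argument \<open>r\<close> is the modulus
  (not the parameter \<open>r\<^sup>2\<close>); the definition is meant for \<open>0 < r < 1\<close>, where the
  integrand is continuous on the closed interval and the base of \<open>powr\<close> is positive.
\<close>

definition ellipticK :: "real \<Rightarrow> real" where
  "ellipticK r = integral {0..pi/2} (\<lambda>t. (1 - r\<^sup>2 * (sin t)\<^sup>2) powr (-1/2))"

definition lambda_of :: "(real \<Rightarrow> real) \<Rightarrow> real \<Rightarrow> real" where
  "lambda_of f x = f (x\<^sup>2)"

end

theory Submission
  imports Defs
begin

text \<open>
  The constants \<open>1 / omega n\<close> are, up to the common factor \<open>\<pi> / 2\<close>, the power series coefficients of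
  \<open>x \<mapsto> ellipticK (sqrt x)\<close> (lemmas \<open>ellipticK_sums\<close> and
  \<open>omega_conv_inv_sqrt_coeff\<close>). The hypothesis on \<open>a n * omega n\<close> therefore compares two power series coefficient by coefficient, and a quotient of power series inherits
  the monotonicity of the quotients of its coefficients if the denominator has nonnegative
  coefficients: for a numerator \<open>f\<close>, a denominator \<open>g\<close>, increasing coefficient quotients and
  \<open>x \<le> y\<close>, the difference \<open>f y * g x - f x * g y\<close> is, after symmetrising a double sum, a sum of
  nonnegative terms (lemma \<open>mono_coeff_ratio_cross_ineq\<close>).

  The inequality for \<open>lambda_of f\<close> compares the quotient at the squares of the two moduli
  \<open>r < 2 * sqrt r / (1 + r)\<close>: by Landen's transformation (lemma \<open>ellipticK_landen\<close>), passing from the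
  smaller modulus to the larger one multiplies the elliptic integral by exactly \<open>1 + r\<close>.

  Landen's transformation itself comes from Parseval's identity. Pulling the factor \<open>1 + r\<close> out of
  the integral for the larger modulus leaves the integrand
  \<open>(1 + 2 * r * cos (2 * t) + r\<^sup>2) powr (-1/2)\<close>, which is the squared absolute value of
  \<open>(1 - z) powr (-1/2)\<close> at \<open>z = - r * cis (2 * t)\<close>. Its integral is thus \<open>\<pi> / 2\<close> times the sum of the
  squared coefficients of the binomial series, with \<open>r ^ n\<close> absorbed into the \<open>n\<close>-th one. By Wallis'
  integrals that is the power series of the elliptic integral of modulus \<open>r\<close>.

  The decreasing case is the increasing case for \<open>- f\<close>.
\<close>

section \<open>Quotients of power series\<close>

text \<open>
  The difference of the two sides is a double sum over \<open>m\<close> and \<open>n\<close>. Adding the terms at \<open>(m, n)\<close> and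
  \<open>(n, m)\<close> yields the product of \<open>u m - u n\<close> and \<open>y ^ m * x ^ n - x ^ m * y ^ n\<close>, up to a nonnegative
  factor, and these two are both nonnegative for \<open>m \<ge> n\<close> and both nonpositive for \<open>m \<le> n\<close>. The
  partial sums suffice, so no rearrangement of infinite double series is involved.
\<close>

lemma mono_coeff_ratio_cross_ineq_finite:
  fixes u b :: "nat \<Rightarrow> real"
  assumes u: "incseq u" and b: "\<And>n. b n \<ge> 0" and xy: "0 \<le> x" "x \<le> y"
  shows "(\<Sum>m<N. u m * b m * x ^ m) * (\<Sum>n<N. b n * y ^ n)
       \<le> (\<Sum>m<N. u m * b m * y ^ m) * (\<Sum>n<N. b n * x ^ n)"
proof -
  define T where "T m n = u m * b m * b n * (y ^ m * x ^ n - x ^ m * y ^ n)" for m n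
  define D where "D = (\<Sum>m<N. u m * b m * y ^ m) * (\<Sum>n<N. b n * x ^ n)
                    - (\<Sum>m<N. u m * b m * x ^ m) * (\<Sum>n<N. b n * y ^ n)"
  have D: "D = (\<Sum>m<N. \<Sum>n<N. T m n)"
    unfolding D_def T_def sum_product sum_subtractf[symmetric]
    by (intro sum.cong refl) (simp add: algebra_simps)
  have ge: "T m n + T n m \<ge> 0" if "n \<le> m" for m n
  proof -
    have "x ^ m = x ^ n * x ^ (m - n)" "y ^ m = y ^ n * y ^ (m - n)"
      using that by (simp_all flip: power_add)
    moreover have "x ^ n * y ^ n * x ^ (m - n) \<le> x ^ n * y ^ n * y ^ (m - n)"
      using xy by (intro mult_left_mono power_mono) auto
    ultimately have "x ^ m * y ^ n \<le> y ^ m * x ^ n"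
      by (simp add: mult_ac)
    moreover have "u n \<le> u m" using u that by (simp add: incseqD)
    moreover have "T m n + T n m = b m * b n * ((u m - u n) * (y ^ m * x ^ n - x ^ m * y ^ n))"
      unfolding T_def by (simp add: algebra_simps)
    ultimately show ?thesis using b by simp
  qed
  have "2 * D = (\<Sum>m<N. \<Sum>n<N. T m n) + (\<Sum>m<N. \<Sum>n<N. T n m)"
    using D sum.swap[of T "{..<N}" "{..<N}"] by simp
  also have "\<dots> = (\<Sum>m<N. \<Sum>n<N. T m n + T n m)"
    by (simp add: sum.distrib)
  also have "\<dots> \<ge> 0"
    by (intro sum_nonneg) (metis ge add.commute nat_le_linear)
  finally show ?thesis unfolding D_def by simp
qed

text \<open>
  The cross-multiplied form of the monotonicity of a quotient of power series whose coefficient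
  quotients \<open>u n\<close> increase.
\<close>

lemma mono_coeff_ratio_cross_ineq:
  fixes u b :: "nat \<Rightarrow> real"
  assumes u: "incseq u" and b: "\<And>n. b n \<ge> 0" and xy: "0 \<le> x" "x \<le> y"
    and fx: "(\<lambda>n. u n * b n * x ^ n) sums fx" and fy: "(\<lambda>n. u n * b n * y ^ n) sums fy"
    and gx: "(\<lambda>n. b n * x ^ n) sums gx" and gy: "(\<lambda>n. b n * y ^ n) sums gy"
  shows "fx * gy \<le> fy * gx"
proof (rule LIMSEQ_le)
  show "(\<lambda>N. (\<Sum>m<N. u m * b m * x ^ m) * (\<Sum>n<N. b n * y ^ n)) \<longlonglongrightarrow> fx * gy"
    using fx gy unfolding sums_def by (rule tendsto_mult)
  show "(\<lambda>N. (\<Sum>m<N. u m * b m * y ^ m) * (\<Sum>n<N. b n * x ^ n)) \<longlonglongrightarrow> fy * gx"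
    using fy gx unfolding sums_def by (rule tendsto_mult)
qed (use mono_coeff_ratio_cross_ineq_finite[OF u b xy] in auto)

section \<open>Termwise integration\<close>

lemma sums_integral_Weierstrass:
  fixes F :: "nat \<Rightarrow> real \<Rightarrow> real"
  assumes cont: "\<And>n. continuous_on {a..b} (F n)"
    and bound: "\<And>n t. t \<in> {a..b} \<Longrightarrow> \<bar>F n t\<bar> \<le> M n" and M: "summable M"
    and int: "\<And>n. (F n has_integral I n) {a..b}"
    and G: "\<And>t. t \<in> {a..b} \<Longrightarrow> (\<lambda>n. F n t) sums G t"
  shows "I sums integral {a..b} G"
proof -
  have "uniform_limit {a..b} (\<lambda>n t. \<Sum>i<n. F i t) (\<lambda>t. \<Sum>i. F i t) sequentially"
    using bound M by (intro Weierstrass_m_test) auto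
  also have "?this \<longleftrightarrow> uniform_limit {a..b} (\<lambda>n t. \<Sum>i<n. F i t) G sequentially"
    by (intro uniform_limit_cong') (use G in \<open>auto simp: sums_iff\<close>)
  finally obtain I' J where
    I': "\<And>n. ((\<lambda>t. \<Sum>i<n. F i t) has_integral I' n) {a..b}"
    and J: "(G has_integral J) {a..b}" "I' \<longlonglongrightarrow> J"
    by (rule uniform_limit_integral) (auto intro!: continuous_on_sum cont)
  have "I' n = (\<Sum>i<n. I i)" for n
    using I'[of n] has_integral_sum[of "{..<n}" F I "{a..b}"] int
    by (auto intro: has_integral_unique)
  then show ?thesis
    using J unfolding sums_def by (metis (no_types, lifting) integral_unique ext)
qed

text \<open>
  Orthogonality on a quarter period: the even frequencies already integrate to zero over
  \<open>{0..\<pi>/2}\<close>, so Parseval's identity below needs no change of variables to a full circle.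
\<close>

lemma has_integral_cos_even_multiple:
  fixes k :: int
  shows "((\<lambda>t. cos (2 * of_int k * t)) has_integral (if k = 0 then pi / 2 else 0)) {0..pi/2}"
proof (cases "k = 0")
  case True
  then show ?thesis using has_integral_const_real[of "1::real" 0 "pi/2"] by simp
next
  case False
  have "((\<lambda>t. cos (2 * of_int k * t)) has_integral
          (sin (2 * of_int k * (pi/2)) / (2 * of_int k) - sin (2 * of_int k * 0) / (2 * of_int k))) {0..pi/2}"
    using False
    by (intro fundamental_theorem_of_calculus)
       (auto intro!: derivative_eq_intros simp: has_real_derivative_iff_has_vector_derivative[symmetric])
  moreover have "sin (2 * real_of_int k * (pi/2)) = 0"
    by (simp add: sin_zero_iff_int2)
  ultimately show ?thesis using False by simp
qed

text \<open>
  The Cauchy product of the series with its complex conjugate expresses the squared absolute value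
  as a series of cosines. Its \<open>n\<close>-th term collects the frequencies \<open>2 * (2 * k - n)\<close> for \<open>k \<le> n\<close>, of which
  only \<open>n = 2 * k\<close> survives integration. Hence the odd terms vanish and the term \<open>2 * m\<close> contributes
  the square of the \<open>m\<close>-th coefficient.
\<close>

lemma Parseval_cis:
  fixes d :: "nat \<Rightarrow> real"
  assumes d: "summable (\<lambda>n. \<bar>d n\<bar>)"
    and S: "\<And>t. t \<in> {0..pi/2} \<Longrightarrow> (\<lambda>n. of_real (d n) * cis (2 * t) ^ n) sums S t"
  shows "(\<lambda>m. pi / 2 * (d m)\<^sup>2) sums integral {0..pi/2} (\<lambda>t. (cmod (S t))\<^sup>2)"
proof -
  define F where
    "F n t = (\<Sum>k\<le>n. d k * d (n - k) * cos (2 * of_int (2 * int k - int n) * t))" for n t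
  define I where
    "I n = (\<Sum>k\<le>n. d k * d (n - k) * (if 2 * int k - int n = 0 then pi / 2 else 0))" for n
  have "I sums integral {0..pi/2} (\<lambda>t. (cmod (S t))\<^sup>2)"
  proof (rule sums_integral_Weierstrass)
    show "continuous_on {0..pi/2} (F n)" for n
      unfolding F_def by (intro continuous_intros)
    show "\<bar>F n t\<bar> \<le> (\<Sum>k\<le>n. \<bar>d k\<bar> * \<bar>d (n - k)\<bar>)" for n t
      unfolding F_def
      by (intro order.trans[OF sum_abs] sum_mono) (auto simp: abs_mult intro!: mult_left_le)
    show "summable (\<lambda>n. \<Sum>k\<le>n. \<bar>d k\<bar> * \<bar>d (n - k)\<bar>)"
      using d by (intro summable_Cauchy_product) simp_all
    show "(F n has_integral I n) {0..pi/2}" for n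
      unfolding F_def I_def
      by (intro has_integral_sum has_integral_mult_right has_integral_cos_even_multiple) auto
  next
    fix t :: real assume t: "t \<in> {0..pi/2}"
    let ?z = "cis (2 * t)"
    have abs: "summable (\<lambda>n. norm (of_real (d n) * ?z ^ n))"
      using d by (simp add: norm_mult norm_power)
    have abs': "summable (\<lambda>n. norm (of_real (d n) * cnj ?z ^ n))"
      using d by (simp add: norm_mult norm_power)
    have S': "(\<lambda>n. of_real (d n) * cnj ?z ^ n) sums cnj (S t)"
      using S[OF t] sums_cnj[of "\<lambda>n. of_real (d n) * ?z ^ n" "S t"] by simp
    have "(\<lambda>n. \<Sum>k\<le>n. (of_real (d k) * ?z ^ k) * (of_real (d (n - k)) * cnj ?z ^ (n - k)))
            sums (S t * cnj (S t))"
      using Cauchy_product_sums[OF abs abs'] S[OF t] S' by (simp add: sums_iff)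
    then have "(\<lambda>n. Re (\<Sum>k\<le>n. (of_real (d k) * ?z ^ k) * (of_real (d (n - k)) * cnj ?z ^ (n - k))))
            sums Re (S t * cnj (S t))"
      by (rule sums_Re)
    moreover have "Re (\<Sum>k\<le>n. (of_real (d k) * ?z ^ k) * (of_real (d (n - k)) * cnj ?z ^ (n - k)))
                     = F n t" for n
      unfolding F_def Re_sum
    proof (intro sum.cong refl)
      fix k assume k: "k \<in> {..n}"
      have "?z ^ k * cnj ?z ^ (n - k) = cis (2 * of_int (2 * int k - int n) * t)"
        using k by (simp add: Complex.DeMoivre cis_cnj cis_mult of_nat_diff) (simp add: algebra_simps)
      then have "(of_real (d k) * ?z ^ k) * (of_real (d (n - k)) * cnj ?z ^ (n - k))
               = of_real (d k * d (n - k)) * cis (2 * of_int (2 * int k - int n) * t)"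
        by (metis (no_types, lifting) mult.assoc mult.left_commute of_real_mult)
      then show "Re ((of_real (d k) * ?z ^ k) * (of_real (d (n - k)) * cnj ?z ^ (n - k)))
               = d k * d (n - k) * cos (2 * of_int (2 * int k - int n) * t)"
        by (simp del: of_real_mult)
    qed
    ultimately show "(\<lambda>n. F n t) sums (cmod (S t))\<^sup>2"
      by (simp only: complex_norm_square[symmetric] Re_complex_of_real)
  qed
  moreover have "I n = 0" if "n \<notin> range (\<lambda>m. 2 * m)" for n
  proof -
    have "2 * int k - int n \<noteq> 0" for k
      using that by (metis eq_iff_diff_eq_0 of_nat_eq_iff of_nat_mult of_nat_numeral rangeI)
    then show ?thesis unfolding I_def by (intro sum.neutral) simp
  qed
  moreover have "strict_mono (\<lambda>m::nat. 2 * m)"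
    by (auto simp: strict_mono_def)
  ultimately have "(\<lambda>m. I (2 * m)) sums integral {0..pi/2} (\<lambda>t. (cmod (S t))\<^sup>2)"
    by (subst sums_mono_reindex)
  moreover have "I (2 * m) = pi / 2 * (d m)\<^sup>2" for m
  proof -
    have "I (2 * m) = (\<Sum>k\<le>2 * m. if k = m then pi / 2 * (d m)\<^sup>2 else 0)"
      unfolding I_def by (intro sum.cong refl) (auto simp: power2_eq_square)
    then show ?thesis by simp
  qed
  ultimately show ?thesis by simp
qed

section \<open>The power series of the elliptic integral\<close>

text \<open>The coefficients of the binomial series of \<open>(1 - x) powr (-1/2)\<close>.\<close>

definition inv_sqrt_coeff :: "nat \<Rightarrow> real" where
  "inv_sqrt_coeff n = pochhammer (1/2) n / fact n"

lemma inv_sqrt_coeff_pos: "inv_sqrt_coeff n > 0"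
  unfolding inv_sqrt_coeff_def by (simp add: pochhammer_pos)

lemma inv_sqrt_coeff_Suc:
  "inv_sqrt_coeff (Suc n) = (2 * real n + 1) / (2 * real n + 2) * inv_sqrt_coeff n"
  unfolding inv_sqrt_coeff_def by (simp add: pochhammer_Suc field_simps)

lemma omega_conv_inv_sqrt_coeff: "omega n = 1 / (inv_sqrt_coeff n)\<^sup>2"
  unfolding omega_def inv_sqrt_coeff_def by (simp add: pochhammer_fact[symmetric] power_divide)

lemma gbinomial_minus_half:
  "(-1/2) gchoose n = (-1) ^ n * (of_real (inv_sqrt_coeff n) :: 'a :: {real_normed_field})"
proof -
  have "(of_real (pochhammer (1/2) n) :: 'a) = pochhammer (1/2) n"
    by (simp add: pochhammer_of_real[symmetric])
  then show ?thesis
    unfolding inv_sqrt_coeff_def by (simp add: gbinomial_pochhammer)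
qed

lemma inv_sqrt_series_complex:
  assumes "cmod z < 1"
  shows "(\<lambda>n. of_real (inv_sqrt_coeff n) * z ^ n) sums (1 - z) powr (-1/2)"
proof -
  have "((-1/2) gchoose n) * (-z) ^ n = of_real (inv_sqrt_coeff n) * z ^ n" for n
    unfolding gbinomial_minus_half power_minus[of z] by (simp flip: power_mult_distrib)
  then show ?thesis
    using gen_binomial_complex[of "-z" "-1/2"] assms by simp
qed

lemma inv_sqrt_series_real:
  fixes x :: real
  assumes "\<bar>x\<bar> < 1"
  shows "(\<lambda>n. inv_sqrt_coeff n * x ^ n) sums (1 - x) powr (-1/2)"
proof -
  have "((-1/2) gchoose n) * (-x) ^ n = inv_sqrt_coeff n * x ^ n" for n
    unfolding gbinomial_minus_half power_minus[of x] by (simp flip: power_mult_distrib)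
  then show ?thesis
    using gen_binomial_real[of "-x" "-1/2"] assms by simp
qed

text \<open>
  The function \<open>sin t ^ (2 * n + 1) * cos t\<close> vanishes at both ends of the interval, so its derivative
  has integral zero. This relates the integrals of consecutive even powers of the sine by the
  factor that \<open>inv_sqrt_coeff\<close> obeys.
\<close>

lemma Wallis_sin_power_integral:
  "((\<lambda>t. sin t ^ (2 * n)) has_integral (pi / 2 * inv_sqrt_coeff n)) {0..pi/2}"
proof (induction n)
  case 0
  then show ?case
    using has_integral_const_real[of "1::real" 0 "pi/2"] by (simp add: inv_sqrt_coeff_def)
next
  case (Suc n)
  let ?P = "\<lambda>t::real. sin t ^ Suc (2 * n) * cos t"
  let ?P' = "\<lambda>t::real. (2 * real n + 1) * sin t ^ (2 * n) - (2 * real n + 2) * sin t ^ (2 * Suc n)"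
  have der: "(?P has_real_derivative ?P' t) (at t within A)" for t A
  proof (rule DERIV_cong)
    show "(?P has_real_derivative
        (1 + real (2 * n)) * (cos t * sin t ^ (2 * n)) * cos t + - sin t * sin t ^ Suc (2 * n)) (at t within A)"
      by (intro DERIV_mult DERIV_power_Suc DERIV_subset[OF DERIV_sin] DERIV_subset[OF DERIV_cos] subset_UNIV)
    have "(1 + real (2 * n)) * (cos t * sin t ^ (2 * n)) * cos t + - sin t * sin t ^ Suc (2 * n)
        = (2 * real n + 1) * sin t ^ (2 * n) * (cos t)\<^sup>2 - sin t ^ (2 * n) * (sin t)\<^sup>2"
      by (simp add: power2_eq_square algebra_simps)
    also have "\<dots> = ?P' t"
      unfolding cos_squared_eq by (simp add: power2_eq_square algebra_simps)
    finally show "(1 + real (2 * n)) * (cos t * sin t ^ (2 * n)) * cos t + - sin t * sin t ^ Suc (2 * n) = ?P' t" .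
  qed
  have "(?P' has_integral ?P (pi/2) - ?P 0) {0..pi/2}"
    using der[THEN has_real_derivative_iff_has_vector_derivative[THEN iffD1]]
    by (intro fundamental_theorem_of_calculus) simp_all
  then have "(?P' has_integral 0) {0..pi/2}" by simp
  from has_integral_diff[OF has_integral_mult_right[OF Suc.IH, of "2 * real n + 1"] this]
  have "((\<lambda>t. (2 * real n + 2) * sin t ^ (2 * Suc n)) has_integral
          (2 * real n + 1) * (pi / 2 * inv_sqrt_coeff n)) {0..pi/2}"
    by simp
  note scaled = has_integral_mult_right[OF this, of "1 / (2 * real n + 2)"]
  have "1 / (2 * real n + 2) * ((2 * real n + 2) * w) = w" for w :: real
    by (simp add: field_simps)
  moreover have "1 / (2 * real n + 2) * ((2 * real n + 1) * (pi / 2 * inv_sqrt_coeff n))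
      = pi / 2 * inv_sqrt_coeff (Suc n)"
    by (simp add: inv_sqrt_coeff_Suc)
  ultimately show ?case using scaled by (simp only:)
qed

text \<open>
  Each coefficient is a square because one factor stems from the binomial series and an equal one
  from the integral of \<open>sin t ^ (2 * n)\<close>. Keeping \<open>r ^ n\<close> inside the square gives the shape that
  Parseval's identity produces.
\<close>

lemma ellipticK_sums:
  assumes r: "0 \<le> r" "r < 1"
  shows "(\<lambda>n. pi / 2 * (inv_sqrt_coeff n * r ^ n)\<^sup>2) sums ellipticK r"
  unfolding ellipticK_def
proof (rule sums_integral_Weierstrass)
  have r2: "r\<^sup>2 < 1" using r by (simp add: abs_square_less_1)
  show "continuous_on {0..pi/2} (\<lambda>t. inv_sqrt_coeff n * (r\<^sup>2 * (sin t)\<^sup>2) ^ n)" for n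
    by (intro continuous_intros)
  show "summable (\<lambda>n. inv_sqrt_coeff n * (r\<^sup>2) ^ n)"
    using inv_sqrt_series_real[of "r\<^sup>2"] r2 by (auto simp: sums_iff)
  have le: "r\<^sup>2 * (sin t)\<^sup>2 \<le> r\<^sup>2" for t
    by (intro mult_left_le) (auto simp: abs_square_le_1)
  then show "\<bar>inv_sqrt_coeff n * (r\<^sup>2 * (sin t)\<^sup>2) ^ n\<bar> \<le> inv_sqrt_coeff n * (r\<^sup>2) ^ n" for n t
    using inv_sqrt_coeff_pos[of n]
    by (auto simp: abs_mult power_abs intro!: mult_left_mono power_mono)
  show "(\<lambda>n. inv_sqrt_coeff n * (r\<^sup>2 * (sin t)\<^sup>2) ^ n) sums (1 - r\<^sup>2 * (sin t)\<^sup>2) powr (-1/2)" for t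
    using le[of t] r2 by (intro inv_sqrt_series_real) (simp add: abs_mult)
  show "((\<lambda>t. inv_sqrt_coeff n * (r\<^sup>2 * (sin t)\<^sup>2) ^ n) has_integral
          pi / 2 * (inv_sqrt_coeff n * r ^ n)\<^sup>2) {0..pi/2}" for n
    using has_integral_mult_right[OF Wallis_sin_power_integral[of n],
        of "inv_sqrt_coeff n * (r\<^sup>2) ^ n"]
    by (simp add: power_mult_distrib power_mult power2_eq_square mult_ac)
qed

lemma ellipticK_pos:
  assumes "0 \<le> r" "r < 1"
  shows "ellipticK r > 0"
proof -
  have "0 < pi / 2 * (inv_sqrt_coeff 0 * r ^ 0)\<^sup>2" using inv_sqrt_coeff_pos[of 0] by simp
  also have "\<dots> \<le> ellipticK r"
    using sum_le_suminf[of "\<lambda>n. pi / 2 * (inv_sqrt_coeff n * r ^ n)\<^sup>2" "{0}"]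
      ellipticK_sums[OF assms] by (simp add: sums_iff)
  finally show ?thesis .
qed

section \<open>Landen's transformation\<close>

lemma landen_modulus_bounds:
  fixes r :: real
  assumes "0 < r" "r < 1"
  shows "r < 2 * sqrt r / (1 + r)" "2 * sqrt r / (1 + r) < 1"
proof -
  define s where "s = sqrt r"
  have s: "0 < s" "s < 1" "r = s\<^sup>2" using assms by (auto simp: s_def)
  have "(1 - s)\<^sup>2 > 0" using s by simp
  then have "2 * s < 1 + r" using s by (simp add: power2_eq_square algebra_simps)
  then show "2 * sqrt r / (1 + r) < 1" using assms by (simp add: s_def)
  have "s * (1 + r) < 1 * 2" using s assms by (intro mult_strict_mono) auto
  then have "s * (s * (1 + r)) < s * 2" using s by (intro mult_strict_left_mono) auto
  then have "r * (1 + r) < 2 * s" using s(3) by (simp add: power2_eq_square algebra_simps)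
  then show "r < 2 * sqrt r / (1 + r)" using assms by (simp add: s_def field_simps)
qed

text \<open>
  Landen's ascending transformation. The key identity is
  \<open>(1 + r)\<^sup>2 - 4 * r * (sin t)\<^sup>2 = 1 + 2 * r * cos (2 * t) + r\<^sup>2\<close>: up to the factor \<open>1 + r\<close>, it turns
  the integrand for the larger modulus into a squared absolute value to which Parseval's identity applies.
\<close>

lemma ellipticK_landen:
  assumes r: "0 < r" "r < 1"
  shows "ellipticK (2 * sqrt r / (1 + r)) = (1 + r) * ellipticK r"
proof -
  define y where "y = 2 * sqrt r / (1 + r)"
  define z where "z t = - of_real r * cis (2 * t)" for t
  define S where "S t = (1 - z t) powr (-1/2)" for t
  define d where "d n = inv_sqrt_coeff n * (- r) ^ n" for n
  have z: "cmod (z t) = r" for t using r by (simp add: z_def norm_mult)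
  have "(\<lambda>n. of_real (d n) * cis (2 * t) ^ n) sums S t" for t
    using inv_sqrt_series_complex[of "z t"] z[of t] r
    unfolding S_def d_def by (simp add: z_def power_mult_distrib mult_ac flip: of_real_minus)
  moreover have "summable (\<lambda>n. \<bar>d n\<bar>)"
    using inv_sqrt_series_real[of r] r inv_sqrt_coeff_pos
    by (simp add: d_def abs_mult power_abs sums_iff less_imp_le)
  ultimately have "(\<lambda>m. pi / 2 * (d m)\<^sup>2) sums integral {0..pi/2} (\<lambda>t. (cmod (S t))\<^sup>2)"
    by (intro Parseval_cis)
  moreover have "(d m)\<^sup>2 = (inv_sqrt_coeff m * r ^ m)\<^sup>2" for m
    by (simp add: d_def power_mult_distrib flip: power_mult)
  ultimately have K: "integral {0..pi/2} (\<lambda>t. (cmod (S t))\<^sup>2) = ellipticK r"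
    using ellipticK_sums[of r] r sums_unique2 by simp
  have inv_sqrt_square: "w\<^sup>2 powr (-1/2) = 1 / w" if "w > 0" for w :: real
    using that by (simp add: powr_minus powr_half_sqrt field_simps)
  have "(1 - y\<^sup>2 * (sin t)\<^sup>2) powr (-1/2) = (1 + r) * (cmod (S t))\<^sup>2" for t
  proof -
    have "(cmod (1 - z t))\<^sup>2 = (1 + r * cos (2 * t))\<^sup>2 + (r * sin (2 * t))\<^sup>2"
      by (simp add: cmod_power2 z_def)
    also have "\<dots> = 1 + 2 * r * cos (2 * t) + r\<^sup>2 * ((sin (2 * t))\<^sup>2 + (cos (2 * t))\<^sup>2)"
      by (simp only: power2_eq_square distrib_left distrib_right mult_1 mult_1_right) (simp add: mult_ac)
    also have "\<dots> = (1 + r)\<^sup>2 - 4 * r * (sin t)\<^sup>2"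
      unfolding sin_cos_squared_add unfolding cos_double_sin by (simp add: power2_eq_square algebra_simps)
    also have "\<dots> = (1 + r)\<^sup>2 * (1 - y\<^sup>2 * (sin t)\<^sup>2)"
      using r by (simp add: y_def power_divide power_mult_distrib field_simps)
    finally have eq: "1 - y\<^sup>2 * (sin t)\<^sup>2 = (cmod (1 - z t) / (1 + r))\<^sup>2"
      using r by (simp add: power_divide field_simps)
    have pos: "cmod (1 - z t) > 0" using z[of t] r by auto
    have "(1 - y\<^sup>2 * (sin t)\<^sup>2) powr (-1/2) = (1 + r) / cmod (1 - z t)"
      unfolding eq using pos r by (subst inv_sqrt_square) simp_all
    moreover have "cmod (S t) = cmod (1 - z t) powr (-1/2)"
      unfolding S_def by (subst norm_powr_real_powr') simp_all
    then have "cmod (S t) = 1 / sqrt (cmod (1 - z t))"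
      using pos by (simp add: powr_minus powr_half_sqrt inverse_eq_divide)
    then have "(cmod (S t))\<^sup>2 = 1 / cmod (1 - z t)"
      by (simp add: power_divide)
    ultimately show ?thesis by simp
  qed
  then show ?thesis
    using K unfolding y_def[symmetric] by (simp add: ellipticK_def[of y])
qed

section \<open>Monotonicity of the quotient and the Landen inequality\<close>

lemma increasing_ratio_ellipticK:
  fixes a :: "nat \<Rightarrow> real" and f :: "real \<Rightarrow> real"
  assumes f: "\<And>x. x \<in> {0<..<1} \<Longrightarrow> (\<lambda>n. a n * x ^ n) sums f x"
    and inc: "incseq (\<lambda>n. a n * omega n)"
  shows "mono_on {0<..<1} (\<lambda>x. f x / ellipticK (sqrt x))"
proof (rule mono_onI)
  fix x y :: real assume xy: "x \<in> {0<..<1}" "y \<in> {0<..<1}" "x \<le> y"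
  (* ?b are the coefficients of the denominator and ?u the coefficient quotients. *)
  let ?b = "\<lambda>n. pi / 2 * (inv_sqrt_coeff n)\<^sup>2"
  let ?u = "\<lambda>n. 2 / pi * (a n * omega n)"
  have a: "?u n * ?b n = a n" for n
    using inv_sqrt_coeff_pos[of n] by (simp add: omega_conv_inv_sqrt_coeff)
  have K: "(\<lambda>n. ?b n * w ^ n) sums ellipticK (sqrt w)" if "w \<in> {0<..<1}" for w
    using ellipticK_sums[of "sqrt w"] that
    by (simp add: power_mult_distrib mult_ac flip: real_sqrt_power)
  have "f x * ellipticK (sqrt y) \<le> f y * ellipticK (sqrt x)"
  proof (rule mono_coeff_ratio_cross_ineq[where u = ?u and b = ?b])
    show "incseq ?u" using inc by (auto simp: incseq_def intro!: divide_right_mono mult_left_mono)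
  qed (unfold a, use xy f K in auto)
  moreover have "ellipticK (sqrt x) > 0" "ellipticK (sqrt y) > 0"
    using xy by (auto intro!: ellipticK_pos)
  ultimately show "f x / ellipticK (sqrt x) \<le> f y / ellipticK (sqrt y)"
    by (simp add: field_simps)
qed

text \<open>
  The denominator at the square of the larger modulus is \<open>1 + r\<close> times the denominator at
  \<open>r\<^sup>2\<close>, so comparing the quotients at these two points compares the numerators up to that factor.
\<close>

lemma landen_ineq_of_increasing_ratio:
  assumes mono: "mono_on {0<..<1} (\<lambda>x. f x / ellipticK (sqrt x))"
    and r: "r \<in> {0<..<1}"
  shows "lambda_of f (2 * sqrt r / (1 + r)) \<ge> (1 + r) * lambda_of f r"
proof -
  define y where "y = 2 * sqrt r / (1 + r)"
  have y: "r < y" "y < 1" using landen_modulus_bounds[of r] r by (auto simp: y_def)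
  have "f (r\<^sup>2) / ellipticK (sqrt (r\<^sup>2)) \<le> f (y\<^sup>2) / ellipticK (sqrt (y\<^sup>2))"
    using y r by (intro mono_onD[OF mono]) (auto simp: abs_square_less_1 intro!: power_mono)
  then have "f (r\<^sup>2) / ellipticK r \<le> f (y\<^sup>2) / (1 + r) / ellipticK r"
    using y r ellipticK_landen[of r] by (simp add: y_def[symmetric])
  moreover have "ellipticK r > 0" using r by (intro ellipticK_pos) auto
  ultimately have "f (r\<^sup>2) \<le> f (y\<^sup>2) / (1 + r)" by (auto simp only: divide_le_cancel)
  then show ?thesis
    using r unfolding lambda_of_def y_def[symmetric] by (simp add: field_simps)
qed

theorem theorem2:
  fixes a :: "nat \<Rightarrow> real" and f :: "real \<Rightarrow> real"
  assumes f: "\<And>x. x \<in> {0<..<1} \<Longrightarrow> (\<lambda>n. a n * x ^ n) sums f x"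
  shows "(incseq (\<lambda>n. a n * omega n) \<longrightarrow>
            mono_on {0<..<1} (\<lambda>x. f x / ellipticK (sqrt x)) \<and>
            (\<forall>r\<in>{0<..<1}. lambda_of f (2 * sqrt r / (1 + r)) \<ge> (1 + r) * lambda_of f r)) \<and>
         (decseq (\<lambda>n. a n * omega n) \<longrightarrow>
            antimono_on {0<..<1} (\<lambda>x. f x / ellipticK (sqrt x)) \<and>
            (\<forall>r\<in>{0<..<1}. lambda_of f (2 * sqrt r / (1 + r)) \<le> (1 + r) * lambda_of f r))"
proof (intro conjI impI)
  assume "incseq (\<lambda>n. a n * omega n)"
  then show "mono_on {0<..<1} (\<lambda>x. f x / ellipticK (sqrt x))"
    using increasing_ratio_ellipticK f by blast
  then show "\<forall>r\<in>{0<..<1}. lambda_of f (2 * sqrt r / (1 + r)) \<ge> (1 + r) * lambda_of f r"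
    using landen_ineq_of_increasing_ratio by blast
next
  assume dec: "decseq (\<lambda>n. a n * omega n)"
  have mono: "mono_on {0<..<1} (\<lambda>x. - f x / ellipticK (sqrt x))"
  proof (rule increasing_ratio_ellipticK)
    show "(\<lambda>n. - a n * x ^ n) sums - f x" if "x \<in> {0<..<1}" for x
      using sums_minus[OF f[OF that]] by simp
    show "incseq (\<lambda>n. - a n * omega n)"
      using dec by (simp add: incseq_def decseq_def)
  qed
  then show "antimono_on {0<..<1} (\<lambda>x. f x / ellipticK (sqrt x))"
    by (simp add: monotone_on_def)
  show "\<forall>r\<in>{0<..<1}. lambda_of f (2 * sqrt r / (1 + r)) \<le> (1 + r) * lambda_of f r"
    using landen_ineq_of_increasing_ratio[OF mono] by (simp add: lambda_of_def)
qed

end
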